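(* Let $L_{\mathcal{L}}\subseteq\{0,1\}^*$ be the set of all binary words that are Lyndon words with respect to the order $0<1$ or Lyndon words with respect to the order $1<0$. Then $\mathcal{G}_{L_{\mathcal{L}}}$ contains every graph.
   Context: All graphs are finite, simple, undirected, with nonempty vertex sets, and graph classes are considered up to isomorphism. Given a strict linear order on an alphabet, extended lexicographically to words (a proper prefix is smaller), a Lyndon word is a nonempty word $w$ that is not of the form $u^k$ with $k\geq 2$ and that is lexicographically smallest among its conjugates (words $vu$ where $w=uv$). For an alphabet $V$ and distinct $u,v\in V$, $h_{u,v}:V^*\to\{0,1\}^*$ is the monoid morphism with $u\mapsto 0$, $v\mapsto 1$ and $x\mapsto\lambda$ (empty word) for all other letters $x$. For a language $L\subseteq\{0,1\}^*$ closed under exchanging 0 and 1 and a nonempty word $w$ whose set of occurring letters is $V$, $G(L,w)$ is the graph with vertex set $V$ in which distinct $u,v$ are adjacent iff $h_{u,v}(w)\in L$. $\mathcal{G}_L$ is the class of all graphs isomorphic to some $G(L,w)$. *)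

theory Defs
  imports Main
begin

section \<open>Graphs\<close>

text \<open>The adjacency relation of an undirected graph is stored as a symmetric set of ordered pairs.\<close>

record 'a graph =
  verts :: "'a set"
  adj :: "('a \<times> 'a) set"

definition simple_graph :: "'a graph \<Rightarrow> bool" where
  "simple_graph G \<longleftrightarrow>
     finite (verts G) \<and> verts G \<noteq> {} \<and> adj G \<subseteq> verts G \<times> verts G \<and>
     sym (adj G) \<and> irrefl (adj G)"

definition graph_iso :: "'a graph \<Rightarrow> 'b graph \<Rightarrow> bool" where
  "graph_iso G H \<longleftrightarrow>
     (\<exists>f. bij_betw f (verts G) (verts H) \<and>
          (\<forall>u\<in>verts G. \<forall>v\<in>verts G. (u, v) \<in> adj G \<longleftrightarrow> (f u, f v) \<in> adj H))"


section \<open>Lyndon words\<close>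

definition primitive_word :: "'a list \<Rightarrow> bool" where
  "primitive_word w \<longleftrightarrow> \<not> (\<exists>u k. k \<ge> 2 \<and> w = concat (replicate k u))"

text \<open>The parameter \<open>r\<close> is a strict linear order on the letters; \<^const>\<open>lexord\<close> makes a
  proper prefix smaller.\<close>

definition lyndon :: "('a \<times> 'a) set \<Rightarrow> 'a list \<Rightarrow> bool" where
  "lyndon r w \<longleftrightarrow>
     w \<noteq> [] \<and> primitive_word w \<and>
     (\<forall>u v. w = u @ v \<longrightarrow> w = v @ u \<or> (w, v @ u) \<in> lexord r)"

text \<open>Binary words are boolean lists, with \<^const>\<open>False\<close> for the letter 0 and
  \<^const>\<open>True\<close> for the letter 1.\<close>

definition lyndon_language :: "bool list set" where
  "lyndon_language = {w. lyndon {(False, True)} w \<or> lyndon {(True, False)} w}"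


section \<open>Graphs represented by words\<close>

definition proj_word :: "'a \<Rightarrow> 'a \<Rightarrow> 'a list \<Rightarrow> bool list" where
  "proj_word u v w =
     concat (map (\<lambda>x. if x = u then [False] else if x = v then [True] else []) w)"

definition exchange_closed :: "bool list set \<Rightarrow> bool" where
  "exchange_closed L \<longleftrightarrow> (\<forall>w\<in>L. map Not w \<in> L)"

text \<open>This is meant for \<open>L\<close> with \<^term>\<open>exchange_closed L\<close> and nonempty \<open>w\<close>; see
  \<open>simple_graph_word_graph\<close> below.\<close>

definition word_graph :: "bool list set \<Rightarrow> 'a list \<Rightarrow> 'a graph" where
  "word_graph L w =
     \<lparr> verts = set w,
       adj = {(u, v). u \<in> set w \<and> v \<in> set w \<and> u \<noteq> v \<and> proj_word u v w \<in> L} \<rparr>"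

text \<open>Words over \<^typ>\<open>nat\<close> suffice, since every word uses finitely many letters and the class is
  closed under isomorphism; see \<open>word_graph_in_graph_class\<close> below.\<close>

definition graph_class :: "bool list set \<Rightarrow> 'a graph set" where
  "graph_class L =
     {G. simple_graph G \<and> (\<exists>w :: nat list. w \<noteq> [] \<and> graph_iso G (word_graph L w))}"


section \<open>Well-definedness\<close>

lemma proj_word_swap: "u \<noteq> v \<Longrightarrow> proj_word v u w = map Not (proj_word u v w)"
  by (induction w) (auto simp: proj_word_def)

lemma simple_graph_word_graph:
  assumes "exchange_closed L" "w \<noteq> []"
  shows "simple_graph (word_graph L w)"
  using assms
  by (auto simp: simple_graph_def word_graph_def exchange_closed_def sym_def irrefl_def
      proj_word_swap)

lemma proj_word_map:
  assumes "inj_on f A" "set w \<subseteq> A" "u \<in> A" "v \<in> A"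
  shows "proj_word (f u) (f v) (map f w) = proj_word u v w"
  using assms by (induction w) (auto simp: proj_word_def inj_on_eq_iff)

lemma word_graph_in_graph_class:
  assumes "exchange_closed L" "w \<noteq> []"
  shows "word_graph L w \<in> graph_class L"
proof -
  obtain f :: "'a \<Rightarrow> nat" where f: "inj_on f (set w)"
    using finite_imp_inj_to_nat_seg[of "set w"] by auto
  have "graph_iso (word_graph L w) (word_graph L (map f w))"
    unfolding graph_iso_def
  proof (intro exI[of _ f] conjI)
    show "bij_betw f (verts (word_graph L w)) (verts (word_graph L (map f w)))"
      using f by (auto simp: word_graph_def bij_betw_def)
    show "\<forall>u\<in>verts (word_graph L w). \<forall>v\<in>verts (word_graph L w).
        (u, v) \<in> adj (word_graph L w) \<longleftrightarrow> (f u, f v) \<in> adj (word_graph L (map f w))"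
      using proj_word_map[OF f subset_refl] f
      by (auto simp: word_graph_def inj_on_eq_iff)
  qed
  then show ?thesis
    using assms simple_graph_word_graph by (auto simp: graph_class_def intro!: exI[of _ "map f w"])
qed

lemma lexord_map_Not:
  assumes "(x, y) \<in> lexord r"
  shows "(map Not x, map Not y) \<in> lexord ((\<lambda>(a, b). (\<not> a, \<not> b)) ` r)"
  using assms
proof (induction x arbitrary: y)
  case Nil
  then show ?case by auto
next
  case (Cons a x)
  then obtain b z where "y = b # z" "(a, b) \<in> r \<or> a = b \<and> (x, z) \<in> lexord r"
    by (cases y) auto
  with Cons.IH[of z] show ?case by auto
qed

lemma lyndon_map_Not:
  assumes "lyndon r w"
  shows "lyndon ((\<lambda>(a, b). (\<not> a, \<not> b)) ` r) (map Not w)"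
proof -
  have inv: "map Not (map Not x) = x" for x :: "bool list"
    by (simp add: comp_def)
  have "primitive_word (map Not w)"
    unfolding primitive_word_def
  proof (intro notI, elim exE conjE)
    fix u k assume k: "k \<ge> 2" and "map Not w = concat (replicate k u)"
    then have "w = map Not (concat (replicate k u))"
      using inv by metis
    then have "w = concat (replicate k (map Not u))"
      by (simp add: map_concat)
    with k assms show False
      by (auto simp: lyndon_def primitive_word_def)
  qed
  moreover have "map Not w = v @ u \<or> (map Not w, v @ u) \<in> lexord ((\<lambda>(a, b). (\<not> a, \<not> b)) ` r)"
    if "map Not w = u @ v" for u v
  proof -
    have "w = map Not u @ map Not v"
      using that inv by (metis map_append)
    then have "w = map Not v @ map Not u \<or> (w, map Not v @ map Not u) \<in> lexord r"
      using assms by (auto simp: lyndon_def)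
    then show ?thesis
    proof
      assume "w = map Not v @ map Not u"
      then have "map Not w = v @ u"
        using inv by (metis map_append)
      then show ?thesis ..
    next
      assume "(w, map Not v @ map Not u) \<in> lexord r"
      from lexord_map_Not[OF this] show ?thesis
        using inv by (metis map_append)
    qed
  qed
  ultimately show ?thesis
    using assms by (auto simp: lyndon_def)
qed

lemma exchange_closed_lyndon_language: "exchange_closed lyndon_language"
  using lyndon_map_Not[of "{(False, True)}"] lyndon_map_Not[of "{(True, False)}"]
  by (auto simp: exchange_closed_def lyndon_language_def)

end

theory Submission imports Defs begin

text \<open>
  Take the vertices to be \<open>0, \<dots>, n - 1\<close> and consider a pair \<open>a < b\<close>. The word
  starts with \<open>0\<^sup>5 1\<^sup>5 \<dots> (n - 1)\<^sup>5\<close>, which projects to \<open>F\<^sup>5 T\<^sup>5\<close> (writing \<open>F\<close>, \<open>T\<close> for the two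
  binary letters). For each non-edge \<open>u < v\<close> it continues with \<open>v u\<^sup>3 A u\<^sup>3 v \<rho>\<close>, where \<open>\<rho>\<close> is
  \<open>0 1 \<dots> (n - 1)\<close> and \<open>A\<close> is \<open>\<rho>\<close> without \<open>u\<close> and \<open>v\<close>. Such a block projects to a word containing
  \<open>F\<^sup>6\<close> if \<open>(a, b) = (u, v)\<close>, and otherwise to a word that ends with \<open>T\<close> and whose runs of \<open>F\<close> have
  length at most 4. So if \<open>ab\<close> is an edge, the initial \<open>F\<^sup>5\<close> is the unique longest cyclic run of \<open>F\<close>
  and the projection is Lyndon; if it is not, the conjugate starting with \<open>F\<^sup>6\<close> is smaller.
\<close>

section \<open>Words with short runs of \<open>False\<close>\<close>

text \<open>\<open>short_runs m c xs\<close>: reading \<open>xs\<close> after \<open>c\<close> letters \<open>False\<close>, one never completes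
  \<open>m\<close> consecutive letters \<open>False\<close>.\<close>

fun short_runs :: "nat \<Rightarrow> nat \<Rightarrow> bool list \<Rightarrow> bool" where
  "short_runs m c [] = True"
| "short_runs m c (True # xs) = short_runs m 0 xs"
| "short_runs m c (False # xs) = (Suc c < m \<and> short_runs m (Suc c) xs)"

lemma short_runs_replicate_False:
  "short_runs m c (replicate j False @ xs) \<longleftrightarrow> (j = 0 \<or> c + j < m) \<and> short_runs m (c + j) xs"
  by (induction j arbitrary: c) auto

lemma short_runs_replicate_True:
  "j > 0 \<Longrightarrow> short_runs m c (replicate j True @ xs) \<longleftrightarrow> short_runs m 0 xs"
proof (induction j arbitrary: c)
  case (Suc j)
  then show ?case by (cases j) auto
qed simp

text \<open>The witness is the value of the counter once \<open>xs\<close> has been read.\<close>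

lemma short_runs_appendD: "short_runs m c (xs @ ys) \<Longrightarrow> \<exists>d. short_runs m d ys"
  by (induction m c xs rule: short_runs.induct) auto

text \<open>The final \<open>True\<close> resets the counter, so no run crosses the border.\<close>

lemma short_runs_append_True:
  "short_runs m c (xs @ [True]) \<Longrightarrow> short_runs m 0 ys \<Longrightarrow> short_runs m c (xs @ True # ys)"
  by (induction m c xs rule: short_runs.induct) auto

lemma short_runs_concat:
  assumes "\<And>xs. xs \<in> set xss \<Longrightarrow> \<exists>ys. xs = ys @ [True] \<and> short_runs m 0 xs"
  shows "short_runs m 0 (concat xss)"
  using assms
proof (induction xss)
  case (Cons xs xss)
  then obtain ys where "xs = ys @ [True]" "short_runs m 0 xs" by auto
  with Cons show ?case by (auto intro: short_runs_append_True)
qed simp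

section \<open>Criteria for being and for not being a Lyndon word\<close>

text \<open>Rotating a proper power of \<open>u\<close> by one copy of \<open>u\<close> gives the
  same word back, so strictness for all proper conjugates already forces primitivity.\<close>

lemma lyndonI:
  assumes "w \<noteq> []" "irrefl r"
    and less: "\<And>u v. w = u @ v \<Longrightarrow> u \<noteq> [] \<Longrightarrow> v \<noteq> [] \<Longrightarrow> (w, v @ u) \<in> lexord r"
  shows "lyndon r w"
proof -
  have "primitive_word w"
    unfolding primitive_word_def
  proof (intro notI, elim exE conjE)
    fix u k assume k: "(k::nat) \<ge> 2" and w: "w = concat (replicate k u)"
    obtain j where j: "k = Suc (Suc j)"
      using k by (metis add_2_eq_Suc le_Suc_ex)
    let ?v = "concat (replicate (Suc j) u)"
    have "w = u @ ?v" by (simp add: w j)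
    moreover have comm: "concat (replicate i u) @ u = u @ concat (replicate i u)" for i
      by (induction i) auto
    moreover have "u \<noteq> []" using w assms(1) by auto
    ultimately have "(w, w) \<in> lexord r"
      using less[of u ?v] comm[of "Suc j"] by simp
    with assms(2) show False by (meson irreflD lexord_irreflexive)
  qed
  with assms show ?thesis
    unfolding lyndon_def by (metis append.right_neutral append_Nil)
qed

text \<open>A nonempty proper suffix \<open>v\<close> lies in the word without its first letter, so
  it starts with fewer than \<open>m\<close> letters \<open>False\<close>. The final
  \<open>True\<close> ends this run inside \<open>v\<close>, where the whole word still has
  \<open>False\<close>.\<close>

lemma lyndon_long_first_run:
  assumes "m > 0" "short_runs m 0 (replicate (m - 1) False @ z @ [True])"
  shows "lyndon {(False, True)} (replicate m False @ z @ [True])" (is "lyndon _ ?w")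
proof (rule lyndonI)
  fix u v assume w: "?w = u @ v" and "u \<noteq> []" "v \<noteq> []"
  have "last (u @ v)" unfolding w[symmetric] by simp
  with \<open>v \<noteq> []\<close> have "True \<in> set v" using last_in_set[of v] by simp
  moreover have split: "True \<in> set v \<Longrightarrow> \<exists>j v'. v = replicate j False @ True # v'" for v
  proof (induction v)
    case (Cons a v)
    show ?case
    proof (cases a)
      case True
      then show ?thesis by (auto intro!: exI[of _ 0])
    next
      case False
      with Cons obtain j v' where "v = replicate j False @ True # v'" by auto
      with False show ?thesis by (auto intro!: exI[of _ "Suc j"])
    qed
  qed simp
  ultimately obtain j v' where v: "v = replicate j False @ True # v'" by blast
  have "tl ?w = replicate (m - 1) False @ z @ [True]"
    using assms(1) by (cases m) auto
  moreover have "tl ?w = tl u @ v" using w \<open>u \<noteq> []\<close> by simp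
  ultimately have "\<exists>d. short_runs m d v"
    using assms(2) short_runs_appendD by metis
  with assms(1) v have "j < m" by (auto simp: short_runs_replicate_False)
  then obtain k where "m = j + Suc k" using less_iff_Suc_add by auto
  then have "?w = replicate j False @ False # replicate k False @ z @ [True]"
    by (simp add: replicate_add replicate_app_Cons_same)
  moreover have "v @ u = replicate j False @ True # v' @ u" by (simp add: v)
  ultimately show "(?w, v @ u) \<in> lexord {(False, True)}"
    by (metis lexord_append_leftI lexord_cons_cons singletonI)
qed (auto simp: irrefl_def)

text \<open>Each order has its own smaller conjugate: for \<open>True\<close> before
  \<open>False\<close> the one with the initial run moved to the end, for \<open>False\<close>
  before \<open>True\<close> the one starting at the longer run.\<close>

lemma not_lyndon_longer_run:
  assumes "m > 0" "w = replicate m False @ True # z"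
    and "w = p @ replicate (Suc m) False @ s"
  shows "w \<notin> lyndon_language"
proof -
  have "\<not> lyndon {(True, False)} w"
  proof
    assume "lyndon {(True, False)} w"
    then have "w = (True # z) @ replicate m False
        \<or> (w, (True # z) @ replicate m False) \<in> lexord {(True, False)}"
      unfolding lyndon_def using assms(2) by blast
    with assms(1,2) show False by (cases m) auto
  qed
  moreover have "\<not> lyndon {(False, True)} w"
  proof
    assume "lyndon {(False, True)} w"
    then have "w = (replicate (Suc m) False @ s) @ p
        \<or> (w, (replicate (Suc m) False @ s) @ p) \<in> lexord {(False, True)}"
      unfolding lyndon_def using assms(3) by blast
    moreover have "(replicate (Suc m) False @ s) @ p = replicate m False @ False # s @ p"
      by (simp add: replicate_app_Cons_same)
    ultimately have "w = replicate m False @ False # s @ p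
        \<or> (w, replicate m False @ False # s @ p) \<in> lexord {(False, True)}"
      by (simp only:)
    then show False
      using assms(2) by (simp add: lexord_same_pref_iff)
  qed
  ultimately show ?thesis by (simp add: lyndon_language_def)
qed

section \<open>The representing word and its projections\<close>

lemma proj_word_append: "proj_word a b (xs @ ys) = proj_word a b xs @ proj_word a b ys"
  by (simp add: proj_word_def)

lemma proj_word_concat_map:
  "proj_word a b (concat (map f xs)) = concat (map (\<lambda>x. proj_word a b (f x)) xs)"
  by (induction xs) (auto simp: proj_word_def)

lemma proj_word_replicate:
  "proj_word a b (replicate k x) =
    (if x = a then replicate k False else if x = b then replicate k True else [])"
  by (induction k) (auto simp: proj_word_def)

lemma concat_map_upt_two:
  assumes "a < b" "b < n" "\<And>x. x \<noteq> a \<Longrightarrow> x \<noteq> b \<Longrightarrow> h x = []"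
  shows "concat (map h [0..<n]) = h a @ h b"
proof -
  have "[0..<n] = [0..<a] @ a # [Suc a..<b] @ b # [Suc b..<n]"
    using assms(1,2)
    by (metis append_Cons append_Nil upt_conv_Cons upt_add_eq_append less_imp_add_positive
        le_add1 add_0 less_trans le0 order_less_imp_le le_Suc_ex)
  moreover have "concat (map h xs) = []" if "a \<notin> set xs" "b \<notin> set xs" for xs
    using that assms(3) by (induction xs) auto
  ultimately show ?thesis using assms(1,2) by (simp del: concat_eq_Nil_conv)
qed

text \<open>Written as a concatenation over \<open>[0..<n]\<close> so that
  \<open>concat_map_upt_two\<close> computes its projections.\<close>

definition others :: "nat \<Rightarrow> nat \<Rightarrow> nat \<Rightarrow> nat list" where
  "others n u v = concat (map (\<lambda>x. if x = u \<or> x = v then [] else [x]) [0..<n])"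

definition non_edge_block :: "nat \<Rightarrow> nat \<times> nat \<Rightarrow> nat list" where
  "non_edge_block n = (\<lambda>(u, v).
     [v] @ replicate 3 u @ others n u v @ replicate 3 u @ [v] @ [0..<n])"

definition graph_word :: "nat \<Rightarrow> (nat \<times> nat) list \<Rightarrow> nat list" where
  "graph_word n ns = concat (map (replicate 5) [0..<n]) @ concat (map (non_edge_block n) ns)"

lemma proj_others:
  assumes "a < b" "b < n"
  shows "proj_word a b (others n u v) =
    (if a = u \<or> a = v then [] else [False]) @ (if b = u \<or> b = v then [] else [True])"
  unfolding others_def proj_word_concat_map
  by (rule concat_map_upt_two[OF assms, THEN trans]) (use assms in \<open>auto simp: proj_word_def\<close>)

lemma proj_upt:
  assumes "a < b" "b < n"
  shows "proj_word a b [0..<n] = [False, True]"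
  unfolding proj_word_def
  by (rule concat_map_upt_two[OF assms, THEN trans]) (use assms in \<open>auto simp: proj_word_def\<close>)

lemma proj_prefix:
  assumes "a < b" "b < n"
  shows "proj_word a b (concat (map (replicate 5) [0..<n])) = replicate 5 False @ replicate 5 True"
  unfolding proj_word_concat_map proj_word_replicate
  by (rule concat_map_upt_two[OF assms, THEN trans]) (use assms in auto)

lemma proj_word_Cons:
  "proj_word a b (x # xs) =
    (if x = a then [False] else if x = b then [True] else []) @ proj_word a b xs"
  by (simp add: proj_word_def)

lemmas proj_block_simps = proj_word_append proj_word_replicate proj_others proj_upt
  proj_word_Cons

text \<open>The extreme case is \<open>a = u\<close>, \<open>b \<noteq> v\<close>: the letter
  \<open>b\<close> in \<open>others\<close> splits the two triples, and the closing
  \<open>[0..<n]\<close> lengthens the second one to four, giving \<open>FFFTFFFFT\<close>.\<close>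

lemma proj_non_edge_block_other:
  assumes "a < b" "b < n" "u < v" "(a, b) \<noteq> (u, v)"
  shows "\<exists>ys. proj_word a b (non_edge_block n (u, v)) = ys @ [True]
    \<and> short_runs 5 0 (proj_word a b (non_edge_block n (u, v)))"
  using assms by (auto simp: non_edge_block_def proj_block_simps numeral_eq_Suc)

lemma proj_non_edge_block_same:
  assumes "u < v" "v < n"
  shows "\<exists>p s. proj_word u v (non_edge_block n (u, v)) = p @ replicate 6 False @ s"
  using assms
  by (intro exI[of _ "[True]"] exI[of _ "[True, False, True]"])
    (simp add: non_edge_block_def proj_block_simps numeral_eq_Suc)

lemma proj_graph_word:
  assumes "a < b" "b < n"
  shows "proj_word a b (graph_word n ns) = replicate 5 False @ replicate 5 True
    @ concat (map (\<lambda>e. proj_word a b (non_edge_block n e)) ns)"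
  by (simp add: graph_word_def proj_word_append proj_word_concat_map[of _ _ "non_edge_block n"]
      proj_prefix[OF assms])

lemma proj_graph_word_lyndon_iff:
  assumes "a < b" "b < n" and ns: "\<And>u v. (u, v) \<in> set ns \<Longrightarrow> u < v"
  shows "proj_word a b (graph_word n ns) \<in> lyndon_language \<longleftrightarrow> (a, b) \<notin> set ns"
proof
  let ?bs = "map (\<lambda>e. proj_word a b (non_edge_block n e)) ns"
  assume "(a, b) \<notin> set ns"
  then have blocks: "\<exists>ys. xs = ys @ [True] \<and> short_runs 5 0 xs" if "xs \<in> set ?bs" for xs
    using that ns proj_non_edge_block_other[OF assms(1,2)] by fastforce
  \<comment> \<open>The last letter comes from the last block, or from the prefix if
    \<open>ns\<close> is empty.\<close>
  have "last (replicate 5 True @ concat ?bs)"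
  proof (cases ?bs rule: rev_cases)
    case (snoc bs b)
    then obtain ys where "b = ys @ [True]" using blocks[of b] by auto
    then show ?thesis unfolding snoc by simp
  qed simp
  then obtain z where z: "replicate 5 True @ concat ?bs = z @ [True]"
    by (metis append_butlast_last_id append_is_Nil_conv replicate_empty zero_neq_numeral)
  have "short_runs 5 0 (replicate (5 - 1) False @ z @ [True])"
    unfolding z[symmetric] short_runs_replicate_False
    using short_runs_concat[of ?bs 5] blocks by (simp add: short_runs_replicate_True)
  from lyndon_long_first_run[OF _ this]
  show "proj_word a b (graph_word n ns) \<in> lyndon_language"
    by (simp add: proj_graph_word[OF assms(1,2)] z lyndon_language_def)
next
  assume lyn: "proj_word a b (graph_word n ns) \<in> lyndon_language"
  show "(a, b) \<notin> set ns"
  proof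
    assume "(a, b) \<in> set ns"
    then obtain xs ys where split: "ns = xs @ (a, b) # ys" by (meson split_list)
    obtain p s where ps: "proj_word a b (non_edge_block n (a, b)) = p @ replicate 6 False @ s"
      using proj_non_edge_block_same[OF assms(1,2)] by blast
    let ?f = "\<lambda>e. proj_word a b (non_edge_block n e)"
    have "proj_word a b (graph_word n ns)
        = (replicate 5 False @ replicate 5 True @ concat (map ?f xs) @ p)
          @ replicate (Suc 5) False @ (s @ concat (map ?f ys))"
      unfolding proj_graph_word[OF assms(1,2)] split by (simp add: ps)
    \<comment> \<open>This second factorization shows that the initial run has length exactly
      5.\<close>
    moreover have "proj_word a b (graph_word n ns)
        = replicate 5 False @ True # replicate 4 True @ concat (map ?f ns)"
      unfolding proj_graph_word[OF assms(1,2)] by (simp add: numeral_eq_Suc)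
    ultimately show False
      using lyn not_lyndon_longer_run[of 5] by (metis zero_less_numeral)
  qed
qed

section \<open>Representing an arbitrary graph\<close>

lemma set_graph_word:
  assumes "\<And>u v. (u, v) \<in> set ns \<Longrightarrow> u < v \<and> v < n"
  shows "set (graph_word n ns) = {0..<n}"
  using assms by (fastforce simp: graph_word_def non_edge_block_def others_def split: if_splits)

theorem mainTheorem11:
  fixes G :: "'a graph"
  assumes "simple_graph G"
  shows "G \<in> graph_class lyndon_language"
proof -
  define n where "n = card (verts G)"
  have fin: "finite (verts G)" and ne: "verts G \<noteq> {}" and sym: "sym (adj G)"
    and irr: "irrefl (adj G)"
    using assms by (auto simp: simple_graph_def)
  obtain f where f: "bij_betw f (verts G) {0..<n}"
    using ex_bij_betw_finite_nat[OF fin] by (auto simp: n_def)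
  define g where "g = inv_into (verts G) f"
  have gf: "g (f x) = x" if "x \<in> verts G" for x
    using that f by (simp add: g_def bij_betw_inv_into_left)
  have fn: "f x < n" if "x \<in> verts G" for x
    using that f by (auto dest: bij_betwE)
  \<comment> \<open>The non-edges in the numbering \<open>f\<close>, each listed with its smaller
    end first.\<close>
  define N where "N = {(u, v). u < v \<and> v < n \<and> (g u, g v) \<notin> adj G}"
  have "N \<subseteq> {0..<n} \<times> {0..<n}" by (auto simp: N_def)
  then obtain ns where ns: "set ns = N"
    using finite_list finite_subset by (metis finite_SigmaI finite_atLeastLessThan)
  let ?w = "graph_word n ns"
  have set_w: "set ?w = {0..<n}"
    by (rule set_graph_word) (auto simp: ns N_def)
  have less: "proj_word a b ?w \<in> lyndon_language \<longleftrightarrow> (g a, g b) \<in> adj G" if "a < b" "b < n" for a b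
    using that proj_graph_word_lyndon_iff[of a b n ns] by (auto simp: ns N_def)
  have lyn: "proj_word a b ?w \<in> lyndon_language \<longleftrightarrow> (g a, g b) \<in> adj G"
    if "a < n" "b < n" "a \<noteq> b" for a b
  proof (cases "a < b")
    case False
    with that have "b < a" by simp
    have inv: "map Not (map Not x) = x" for x by (simp add: comp_def)
    \<comment> \<open>Swapping \<open>a\<close> and \<open>b\<close> complements the projection,
      under which the language is closed.\<close>
    have "proj_word a b ?w \<in> lyndon_language \<longleftrightarrow> proj_word b a ?w \<in> lyndon_language"
      using exchange_closed_lyndon_language proj_word_swap[OF that(3), of ?w] inv
      unfolding exchange_closed_def by metis
    also have "\<dots> \<longleftrightarrow> (g a, g b) \<in> adj G"
      using less[OF \<open>b < a\<close>] that sym by (meson symD)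
    finally show ?thesis .
  qed (use less that in auto)
  have "graph_iso G (word_graph lyndon_language ?w)"
    unfolding graph_iso_def
  proof (intro exI[of _ f] conjI ballI)
    show "bij_betw f (verts G) (verts (word_graph lyndon_language ?w))"
      using f by (simp add: word_graph_def set_w)
    fix u v assume uv: "u \<in> verts G" "v \<in> verts G"
    then have "f u = f v \<longleftrightarrow> u = v" using gf by metis
    moreover have "(u, u) \<notin> adj G" using irr by (simp add: irrefl_def)
    ultimately show "(u, v) \<in> adj G \<longleftrightarrow> (f u, f v) \<in> adj (word_graph lyndon_language ?w)"
      using uv lyn[of "f u" "f v"] fn gf by (auto simp: word_graph_def set_w)
  qed
  moreover have "?w \<noteq> []"
    using set_w ne fn by force
  ultimately show ?thesis using assms by (auto simp: graph_class_def)
qed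

end
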